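(* Let $\mu$ be a Borel probability measure on $2^\omega$. Suppose $\{A_i: i\in\omega\}$ is a mutually independent family of subsets of $2^\omega$, and let $s_i\in[0,1)$ be such that $\sum_i s_i=\infty$. If player I has a winning strategy in the measure game $G(s_i,A_i)$ for every $i$, then for every $\epsilon$ with $0<\epsilon\le 1$, player I has a winning strategy in $G\big(1-\epsilon,\bigcup_{m=0}^\infty\bigcap_{i=m}^\infty A_i\big)$.
   Context: $2^\omega$ is the space of infinite binary sequences with the product topology; for $t\in 2^{<\omega}$ (finite binary sequences), $N_t=\{x\in 2^\omega: t\subseteq x\}$, and $t^\frown i$ denotes $t$ extended by the digit $i$. For $A\subseteq 2^\omega$ and $s\in[0,1)$ the measure game $G(s,A)$: in round $n$, after II has played $t=x_0\dots x_{n-1}$, player I plays a pair $(m_{t^\frown0},m_{t^\frown1})$, then II plays $x_n$. Put $m_\emptyset=m_0+m_1$. I must obey: every $m_t$ is rational; $m_0+m_1>s$; $0\le m_t\le\mu(N_t)$; if $\mu(N_t)>0$ then $m_t<\mu(N_t)$; $m_{t^\frown0}+m_{t^\frown1}=m_t$. II must obey: $x_n\in\{0,1\}$ and $m_{x_0\dots x_n}\neq0$. The first player to violate a rule loses; otherwise II wins iff $(x_0,x_1,\dots)\in A$. A family $\{A_i:i\in\mathcal I\}$ of subsets of $2^\omega$ is mutually independent if for every finite $F\subseteq\mathcal I$, every choice of $s_i\in[0,1)$ ($i\in F$), and each player $P\in\{\mathrm{I},\mathrm{II}\}$: if $P$ wins $G(s_i,A_i^c)$ for all $i\in F$, then $P$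 wins $G\big(\prod_{i\in F}s_i,\bigcup_{i\in F}A_i^c\big)$. *)

theory Defs
  imports "HOL-Probability.Probability"
begin

text \<open>
  Points of the Cantor space are functions \<^typ>\<open>nat \<Rightarrow> bool\<close>, with \<^term>\<open>False\<close> for the digit 0 and
  \<^term>\<open>True\<close> for the digit 1; the library topology on this type is the product of the discrete ones.
\<close>

definition cylinder :: "bool list \<Rightarrow> (nat \<Rightarrow> bool) set" where
  "cylinder t = {x. \<forall>k<length t. x k = t ! k}"

datatype player = PlayerI | PlayerII

text \<open>
  Round \<open>n\<close> of a run consists of the pair \<open>(m\<^bsub>t0\<^esub>, m\<^bsub>t1\<^esub>)\<close> played by I and the digit played by II,
  where \<open>t\<close> is the word of II's earlier digits.  Runs are always infinite: since the first violation
  of a rule decides the winner, what is played after it is irrelevant.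
\<close>

type_synonym round = "(real \<times> real) \<times> bool"

definition entry :: "real \<times> real \<Rightarrow> bool \<Rightarrow> real" where
  "entry q i = (if i then snd q else fst q)"

definition outcome :: "(nat \<Rightarrow> round) \<Rightarrow> nat \<Rightarrow> bool" where
  "outcome r n = snd (r n)"

definition word :: "(nat \<Rightarrow> round) \<Rightarrow> nat \<Rightarrow> bool list" where
  "word r n = map (outcome r) [0..<n]"

text \<open>\<open>mass r n\<close> is \<open>m\<^bsub>t\<^esub>\<close> for the word \<open>t\<close> of the first \<open>n\<close> digits.\<close>

fun mass :: "(nat \<Rightarrow> round) \<Rightarrow> nat \<Rightarrow> real" where
  "mass r 0 = entry (fst (r 0)) False + entry (fst (r 0)) True"
| "mass r (Suc n) = entry (fst (r n)) (outcome r n)"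

definition admissible_mass :: "(nat \<Rightarrow> bool) measure \<Rightarrow> bool list \<Rightarrow> real \<Rightarrow> bool" where
  "admissible_mass M t q \<longleftrightarrow>
     q \<in> \<rat> \<and> 0 \<le> q \<and> q \<le> measure M (cylinder t) \<and>
     (measure M (cylinder t) > 0 \<longrightarrow> q < measure M (cylinder t))"

definition legal_I :: "(nat \<Rightarrow> bool) measure \<Rightarrow> real \<Rightarrow> (nat \<Rightarrow> round) \<Rightarrow> nat \<Rightarrow> bool" where
  "legal_I M s r n \<longleftrightarrow>
     (n = 0 \<longrightarrow> mass r 0 > s) \<and>
     admissible_mass M (word r n) (mass r n) \<and>
     (\<forall>i. admissible_mass M (word r n @ [i]) (entry (fst (r n)) i)) \<and>
     entry (fst (r n)) False + entry (fst (r n)) True = mass r n"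

definition legal_II :: "(nat \<Rightarrow> round) \<Rightarrow> nat \<Rightarrow> bool" where
  "legal_II r n \<longleftrightarrow> mass r (Suc n) \<noteq> 0"

text \<open>In each round I moves before II.\<close>

fun won_by :: "(nat \<Rightarrow> bool) measure \<Rightarrow> real \<Rightarrow> (nat \<Rightarrow> bool) set \<Rightarrow> player \<Rightarrow> (nat \<Rightarrow> round) \<Rightarrow> bool" where
  "won_by M s A PlayerI r \<longleftrightarrow>
     (\<exists>n. (\<forall>k<n. legal_I M s r k \<and> legal_II r k) \<and> legal_I M s r n \<and> \<not> legal_II r n) \<or>
     (\<forall>n. legal_I M s r n \<and> legal_II r n) \<and> outcome r \<notin> A"
| "won_by M s A PlayerII r \<longleftrightarrow>
     (\<exists>n. (\<forall>k<n. legal_I M s r k \<and> legal_II r k) \<and> \<not> legal_I M s r n) \<or>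
     (\<forall>n. legal_I M s r n \<and> legal_II r n) \<and> outcome r \<in> A"

definition history :: "(nat \<Rightarrow> round) \<Rightarrow> nat \<Rightarrow> round list" where
  "history r n = map r [0..<n]"

definition follows_I :: "(round list \<Rightarrow> real \<times> real) \<Rightarrow> (nat \<Rightarrow> round) \<Rightarrow> bool" where
  "follows_I \<sigma> r \<longleftrightarrow> (\<forall>n. fst (r n) = \<sigma> (history r n))"

definition follows_II :: "(round list \<Rightarrow> real \<times> real \<Rightarrow> bool) \<Rightarrow> (nat \<Rightarrow> round) \<Rightarrow> bool" where
  "follows_II \<tau> r \<longleftrightarrow> (\<forall>n. snd (r n) = \<tau> (history r n) (fst (r n)))"

fun wins_game :: "(nat \<Rightarrow> bool) measure \<Rightarrow> player \<Rightarrow> real \<Rightarrow> (nat \<Rightarrow> bool) set \<Rightarrow> bool" where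
  "wins_game M PlayerI s A \<longleftrightarrow> (\<exists>\<sigma>. \<forall>r. follows_I \<sigma> r \<longrightarrow> won_by M s A PlayerI r)"
| "wins_game M PlayerII s A \<longleftrightarrow> (\<exists>\<tau>. \<forall>r. follows_II \<tau> r \<longrightarrow> won_by M s A PlayerII r)"

text \<open>
  The finite set \<open>F\<close> is nonempty: for \<open>F = {}\<close> the product would be 1, for which no game is defined
  (the parameter has to lie in \<open>[0,1)\<close>).
\<close>

definition mutually_independent ::
    "(nat \<Rightarrow> bool) measure \<Rightarrow> 'i set \<Rightarrow> ('i \<Rightarrow> (nat \<Rightarrow> bool) set) \<Rightarrow> bool" where
  "mutually_independent M I A \<longleftrightarrow>
     (\<forall>F s P. finite F \<and> F \<noteq> {} \<and> F \<subseteq> I \<and> (\<forall>i\<in>F. 0 \<le> s i \<and> s i < 1) \<and>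
        (\<forall>i\<in>F. wins_game M P (s i) (- A i)) \<longrightarrow>
        wins_game M P (\<Prod>i\<in>F. s i) (\<Union>i\<in>F. - A i))"

lemma won_by_exactly_one: "won_by M s A PlayerI r \<longleftrightarrow> \<not> won_by M s A PlayerII r"
proof -
  have first: "(\<exists>n. (\<forall>k<n. P k \<and> Q k) \<and> P n \<and> \<not> Q n) \<or> (\<forall>n. P n \<and> Q n) \<and> \<not> C \<longleftrightarrow>
      \<not> ((\<exists>n. (\<forall>k<n. P k \<and> Q k) \<and> \<not> P n) \<or> (\<forall>n. P n \<and> Q n) \<and> C)"
    for P Q :: "nat \<Rightarrow> bool" and C
  proof (cases "\<forall>n. P n \<and> Q n")
    case True
    then show ?thesis by simp
  next
    case False
    then obtain N where N: "\<not> (P N \<and> Q N)" and less: "\<forall>k<N. P k \<and> Q k"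
      using exists_least_iff[of "\<lambda>n. \<not> (P n \<and> Q n)"] by auto
    have uniq: "n = N" if "\<forall>k<n. P k \<and> Q k" "\<not> (P n \<and> Q n)" for n
      using N less that by (cases n N rule: linorder_cases) simp_all
    have "(\<exists>n. (\<forall>k<n. P k \<and> Q k) \<and> P n \<and> \<not> Q n) \<longleftrightarrow> P N"
      using uniq N less by metis
    moreover have "(\<exists>n. (\<forall>k<n. P k \<and> Q k) \<and> \<not> P n) \<longleftrightarrow> \<not> P N"
      using uniq N less by metis
    ultimately show ?thesis using N by blast
  qed
  show ?thesis unfolding won_by.simps by (rule first)
qed

end

theory Submission
  imports Defs
begin

text \<open>
  A winning strategy of I in \<open>G(s, A)\<close> amounts to an additive assignment of admissible masses to finite
  words, of total mass greater than \<open>s\<close>, that vanishes along every point of \<open>A\<close>.  Such an assignment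
  exists if some closed set of measure greater than \<open>s\<close> is disjoint from \<open>A\<close>, and it lets II win
  \<open>G(1 - s, - A)\<close>.  So by independence II wins \<open>G(\<Prod>i\<in>F. 1 - s\<^sub>i, \<Union>i\<in>F. - A\<^sub>i)\<close>, where the product is
  arbitrarily small for suitable finite sets \<open>F\<close> of large indices.

  If II wins \<open>G(p, B)\<close>, then the outcomes of the legal runs of her strategy form a Souslin set \<open>W \<subseteq> B\<close>
  such that she also wins \<open>G(p, W)\<close>.  As \<open>W\<close> is measurable for the completion, its measure is at least
  \<open>1 - p\<close>: otherwise its complement would contain a closed set on which I wins.  Hence \<open>B\<close> contains
  closed sets of measure arbitrarily close to \<open>1 - p\<close>.  Choosing such closed subsets of the sets
  \<open>\<Union>i\<ge>m. - A\<^sub>i\<close> with errors summing to less than \<open>\<epsilon>\<close>, and intersecting them over \<open>m\<close>, gives a closed set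
  of measure greater than \<open>1 - \<epsilon>\<close> that is disjoint from \<open>\<Union>m. \<Inter>i\<ge>m. A\<^sub>i\<close>.
\<close>

section \<open>Sequences and trees determined by initial segments\<close>

primrec generated_prefix :: "('a list \<Rightarrow> 'a) \<Rightarrow> nat \<Rightarrow> 'a list" where
  "generated_prefix f 0 = []"
| "generated_prefix f (Suc n) = generated_prefix f n @ [f (generated_prefix f n)]"

definition generated_seq :: "('a list \<Rightarrow> 'a) \<Rightarrow> nat \<Rightarrow> 'a" where
  "generated_seq f n = f (generated_prefix f n)"

lemma generated_seq_unfold: "generated_seq f n = f (map (generated_seq f) [0..<n])"
proof -
  have "map (generated_seq f) [0..<n] = generated_prefix f n"
    by (induction n) (simp_all add: generated_seq_def)
  then show ?thesis by (simp add: generated_seq_def)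
qed

lemma dependent_sequence_choice:
  assumes "P []" and extend: "\<And>h. P h \<Longrightarrow> \<exists>q. P (h @ [q])"
  obtains r where "\<And>n. P (map r [0..<n])"
proof -
  define r where "r = generated_seq (\<lambda>h. SOME q. P (h @ [q]))"
  have "P (map r [0..<n])" for n
  proof (induction n)
    case (Suc n)
    then have "P (map r [0..<n] @ [SOME q. P (map r [0..<n] @ [q])])"
      by (intro someI_ex[of "\<lambda>q. P (map r [0..<n] @ [q])"] extend)
    then show ?case using generated_seq_unfold[of "\<lambda>h. SOME q. P (h @ [q])" n] by (simp add: r_def)
  qed (simp add: assms(1))
  then show thesis by (rule that)
qed

lemma dependent_tree_choice:
  assumes "P [] a" and extend: "\<And>t b. P t b \<Longrightarrow> \<exists>c. R b c \<and> (\<forall>i. P (t @ [i]) (c i))"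
  obtains m where "m [] = a" "\<And>t. P t (m t)" "\<And>t. R (m t) (\<lambda>i. m (t @ [i]))"
proof -
  from extend obtain f where f: "\<And>t b. P t b \<Longrightarrow> R b (f t b) \<and> (\<forall>i. P (t @ [i]) (f t b i))"
    by metis
  define m where "m t = rec_list a (\<lambda>i u b. f (rev u) b i) (rev t)" for t
  have m_Nil: "m [] = a" and m_snoc: "m (t @ [i]) = f t (m t) i" for t i
    by (simp_all add: m_def)
  have P: "P t (m t)" for t
  proof (induction t rule: rev_induct)
    case (snoc i t)
    then show ?case using f by (simp add: m_snoc)
  qed (simp add: m_Nil assms(1))
  then have "R (m t) (\<lambda>i. m (t @ [i]))" for t
    using f by (simp add: m_snoc)
  with m_Nil P show thesis by (rule that)
qed

section \<open>The Souslin operation\<close>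

definition Souslin_operation :: "'a set \<Rightarrow> ('a list \<Rightarrow> 'b set) \<Rightarrow> 'b set" where
  "Souslin_operation Q P = (\<Union>r\<in>UNIV \<rightarrow> Q. \<Inter>n. P (map r [0..<n]))"

lemma mem_Souslin_operation_iff:
  "x \<in> Souslin_operation Q P \<longleftrightarrow> (\<exists>r\<in>UNIV \<rightarrow> Q. \<forall>n. x \<in> P (map r [0..<n]))"
  by (simp add: Souslin_operation_def)

lemma mem_Souslin_operationI:
  assumes "x \<in> P []" and extend: "\<And>h. h \<in> lists Q \<Longrightarrow> x \<in> P h \<Longrightarrow> \<exists>q\<in>Q. x \<in> P (h @ [q])"
  shows "x \<in> Souslin_operation Q P"
proof -
  obtain r where r: "\<And>n. map r [0..<n] \<in> lists Q \<and> x \<in> P (map r [0..<n])"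
  proof (rule dependent_sequence_choice[of "\<lambda>h. h \<in> lists Q \<and> x \<in> P h"])
    show "\<exists>q. h @ [q] \<in> lists Q \<and> x \<in> P (h @ [q])" if "h \<in> lists Q \<and> x \<in> P h" for h
      using extend[of h] that by auto
  qed (use \<open>x \<in> P []\<close> in auto)
  have "r n \<in> Q" for n
    using r[of "Suc n"] by simp
  then show ?thesis
    using r by (auto simp: mem_Souslin_operation_iff)
qed

lemma Souslin_operation_mono:
  "(\<And>h. P h \<subseteq> P' h) \<Longrightarrow> Souslin_operation Q P \<subseteq> Souslin_operation Q P'"
  unfolding subset_iff mem_Souslin_operation_iff by meson

lemma (in sigma_finite_measure) ex_measurable_envelope:
  assumes "A \<subseteq> space M"
  shows "\<exists>E. measurable_envelope M A E"
proof -
  obtain C :: "nat \<Rightarrow> 'a set"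
    where "range C \<subseteq> sets M" "(\<Union>n. C n) = space M" "\<And>n. emeasure M (C n) \<noteq> \<infinity>"
    using sigma_finite by metis
  then show ?thesis
    using measurable_envelopeI_countable_cover[of A C M] assms by (auto simp: less_top)
qed

lemma measurable_envelope_Diff_null_sets:
  assumes E: "measurable_envelope M A E" and U: "U \<in> sets M" "A \<subseteq> U"
  shows "E - U \<in> null_sets M"
proof (rule null_setsI)
  show E_U: "E - U \<in> sets M"
    using measurable_envelopeD(2)[OF E] U(1) by (rule sets.Diff)
  show "emeasure M (E - U) = 0"
    using U(2) by (intro measurable_envelopeD1[OF E E_U]) auto
qed

definition Souslin_branches :: "'a set \<Rightarrow> ('a list \<Rightarrow> 'b set) \<Rightarrow> 'a list \<Rightarrow> 'b set" where
  "Souslin_branches Q P h =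
    {x. \<exists>r\<in>UNIV \<rightarrow> Q. map r [0..<length h] = h \<and> (\<forall>n. x \<in> P (map r [0..<n]))}"

lemma Souslin_branches_Nil: "Souslin_branches Q P [] = Souslin_operation Q P"
  by (simp add: set_eq_iff Souslin_branches_def mem_Souslin_operation_iff)

lemma Souslin_branches_subset: "Souslin_branches Q P h \<subseteq> P h"
  by (auto simp: Souslin_branches_def dest: spec[of _ "length h"])

lemma Souslin_branches_snoc: "Souslin_branches Q P h \<subseteq> (\<Union>q\<in>Q. Souslin_branches Q P (h @ [q]))"
proof
  fix x assume "x \<in> Souslin_branches Q P h"
  then obtain r where r: "r \<in> UNIV \<rightarrow> Q" "map r [0..<length h] = h" "\<And>n. x \<in> P (map r [0..<n])"
    by (auto simp: Souslin_branches_def)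
  then have "r (length h) \<in> Q" "x \<in> Souslin_branches Q P (h @ [r (length h)])"
    by (auto simp: Souslin_branches_def)
  then show "x \<in> (\<Union>q\<in>Q. Souslin_branches Q P (h @ [q]))" by blast
qed

text \<open>
  If the branches through each \<open>h\<close> are enlarged to an envelope \<open>S h\<close>, then a point of \<open>S []\<close> outside the
  null set of points lost in passing from some \<open>S h\<close> to its successors lies on a branch of \<open>S\<close>.
\<close>

lemma (in sigma_finite_measure) Souslin_operation_in_completion:
  assumes Q: "countable Q" and P: "\<And>h. P h \<in> sets M"
  shows "Souslin_operation Q P \<in> sets (completion M)"
proof -
  let ?R = "Souslin_branches Q P"
  have "\<exists>E. measurable_envelope M (?R h) E" for h
    using Souslin_branches_subset sets.sets_into_space[OF P]
    by (intro ex_measurable_envelope) (rule order_trans)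
  then obtain E where E: "\<And>h. measurable_envelope M (?R h) (E h)"
    by metis
  define S where "S h = E h \<inter> P h" for h
  have S_sets: "S h \<in> sets M" and R_S: "?R h \<subseteq> S h" for h
    using measurable_envelopeD(1,2)[OF E, of h] P[of h] Souslin_branches_subset[of Q P h]
    by (auto simp: S_def)
  define U where "U h = (\<Union>q\<in>Q. S (h @ [q]))" for h
  have U_sets: "U h \<in> sets M" for h
    unfolding U_def using S_sets Q by (intro sets.countable_UN') auto
  have R_U: "?R h \<subseteq> U h" for h
    unfolding U_def by (rule order_trans[OF Souslin_branches_snoc UN_mono[OF order_refl R_S]])
  have "S h - U h \<in> null_sets M" for h
    using measurable_envelope_Diff_null_sets[OF E U_sets R_U, of h]
    by (rule null_sets_subset) (use S_sets U_sets in \<open>auto simp: S_def\<close>)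
  then have null: "(\<Union>h\<in>lists Q. S h - U h) \<in> null_sets M" (is "?Z \<in> _")
    using countable_lists[OF Q] by (intro null_sets_UN') auto
  have "S [] - ?Z \<subseteq> Souslin_operation Q S"
    by (intro subsetI mem_Souslin_operationI) (auto simp: U_def)
  also have "\<dots> \<subseteq> Souslin_operation Q P"
    by (rule Souslin_operation_mono) (simp add: S_def)
  finally have "S [] - ?Z \<subseteq> Souslin_operation Q P" .
  moreover have "Souslin_operation Q P \<subseteq> S []"
    using R_S[of "[]"] by (simp add: Souslin_branches_Nil)
  ultimately have "Souslin_operation Q P = (S [] - ?Z) \<union> (Souslin_operation Q P \<inter> ?Z)"
    by blast
  then show ?thesis
    using sets.Diff[OF S_sets null_setsD2[OF null]] by (rule sets_completionI[OF _ Int_lower2 null])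
qed

section \<open>Inner regularity on Polish spaces\<close>

text \<open>The discrete metric on \<^typ>\<open>bool\<close> makes \<^typ>\<open>nat \<Rightarrow> bool\<close> a Polish space for the type class system.\<close>

instantiation bool :: metric_space
begin

definition dist_bool :: "bool \<Rightarrow> bool \<Rightarrow> real" where
  "dist_bool a b = of_bool (a \<noteq> b)"

definition uniformity_bool :: "(bool \<times> bool) filter" where
  "uniformity_bool = (INF e\<in>{0<..}. principal {(a, b). dist a b < e})"

instance
proof
  fix U :: "bool set"
  have "eventually (\<lambda>(a', b). a' = a \<longrightarrow> b \<in> U) uniformity" if "a \<in> U" for a
    unfolding uniformity_bool_def
    using that by (intro eventually_INF1[of 1]) (auto simp: eventually_principal dist_bool_def)
  then show "open U \<longleftrightarrow> (\<forall>a\<in>U. eventually (\<lambda>(a', b). a' = a \<longrightarrow> b \<in> U) uniformity)"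
    by (auto simp: discrete_topology_class.open_discrete)
qed (auto simp: dist_bool_def uniformity_bool_def)

end

instance bool :: polish_space
proof
  show "\<exists>B :: bool set set. countable B \<and> open = generate_topology B"
    unfolding open_bool_def by (intro exI[of _ "range lessThan \<union> range greaterThan"]) auto
next
  fix X :: "nat \<Rightarrow> bool" assume "Cauchy X"
  then obtain N where "\<And>n. n \<ge> N \<Longrightarrow> dist (X n) (X N) < 1"
    unfolding Cauchy_def by (metis order_refl zero_less_one)
  then have "X n = X N" if "n \<ge> N" for n
    using that unfolding dist_bool_def by (metis less_irrefl of_bool_eq(2))
  then have "X \<longlonglongrightarrow> X N"
    by (intro tendsto_eventually eventually_sequentiallyI)
  then show "convergent X"
    by (rule convergentI)
qed

lemma closed_inner_approximation:
  fixes M :: "'a :: polish_space measure"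
  assumes "finite_measure M" and borel: "sets M = sets borel"
    and X: "X \<in> sets (completion M)" and c: "c < measure (completion M) X"
  obtains K where "closed K" "K \<subseteq> X" "c < measure M K"
proof (cases "c < 0")
  case True
  then show thesis using that[of "{}"] by simp
next
  case False
  interpret finite_measure M by (rule assms(1))
  have part: "main_part M X \<in> sets M" "main_part M X \<subseteq> X"
    using main_part_sets[OF X] main_part_null_part_Un[OF X] by blast+
  have "measure (completion M) X = measure M (main_part M X)"
    using X by (simp add: measure_def)
  then have "ennreal c < emeasure M (main_part M X)"
    using c False by (simp add: emeasure_eq_measure ennreal_less_iff)
  then obtain K where K: "K \<subseteq> main_part M X" "compact K" "ennreal c < emeasure M K"
    using inner_regular[OF borel _, of "main_part M X"] part(1) borel by (auto simp: less_SUP_iff)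
  then have "c < measure M K"
    using False by (simp add: emeasure_eq_measure ennreal_less_iff)
  then show thesis using K part(2) compact_imp_closed by (intro that) auto
qed

section \<open>Runs and strategies\<close>

lemma history_Suc: "history r (Suc n) = history r n @ [r n]"
  by (simp add: history_def)

lemma length_history [simp]: "length (history r n) = n"
  by (simp add: history_def)

lemma history_eq_iff: "history r n = history r' n \<longleftrightarrow> (\<forall>k<n. r k = r' k)"
  by (auto simp: history_def)

lemma word_conv_map: "word r n = map (outcome r) [0..<n]"
  by (simp add: word_def)

lemma word_Suc: "word r (Suc n) = word r n @ [outcome r n]"
  by (simp add: word_def)

lemma map_snd_history: "map snd (history r n) = word r n"
  by (simp add: word_def history_def outcome_def)

lemma mass_cong:
  assumes "history r n = history r' n" "fst (r 0) = fst (r' 0)"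
  shows "mass r n = mass r' n"
  using assms by (cases n) (auto simp: history_Suc outcome_def)

lemma
  assumes "history r (Suc n) = history r' (Suc n)"
  shows legal_I_cong: "legal_I M s r n \<longleftrightarrow> legal_I M s r' n"
    and legal_II_cong: "legal_II r n \<longleftrightarrow> legal_II r' n"
proof -
  have eq: "r k = r' k" if "k \<le> n" for k
    using assms that by (simp add: history_eq_iff)
  then have "history r k = history r' k" if "k \<le> Suc n" for k
    using that by (simp add: history_eq_iff)
  then have mass: "mass r k = mass r' k" if "k \<le> Suc n" for k
    using eq that by (intro mass_cong) simp_all
  have "word r n = word r' n"
    using eq by (simp add: word_def outcome_def)
  then show "legal_I M s r n \<longleftrightarrow> legal_I M s r' n"
    using eq mass by (simp add: legal_I_def del: mass.simps)
  show "legal_II r n \<longleftrightarrow> legal_II r' n"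
    using mass by (simp add: legal_II_def del: mass.simps)
qed

lemma won_by_I_iff:
  "won_by M s A PlayerI r \<longleftrightarrow>
    (\<forall>n. (\<forall>k<n. legal_II r k) \<longrightarrow> legal_I M s r n) \<and> ((\<forall>n. legal_II r n) \<longrightarrow> outcome r \<notin> A)"
proof (cases "\<forall>n. legal_II r n")
  case True
  then show ?thesis by auto
next
  case False
  then obtain N where N: "\<not> legal_II r N" "\<forall>k<N. legal_II r k"
    using exists_least_iff[of "\<lambda>n. \<not> legal_II r n"] by auto
  then have "(\<forall>k<n. legal_II r k) \<longleftrightarrow> n \<le> N" for n
    by (metis not_le order_less_le_trans)
  moreover have "(\<forall>k<n. legal_II r k) \<and> \<not> legal_II r n \<longleftrightarrow> n = N" for n
    using N by (metis linorder_neqE_nat)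
  then have "(\<exists>n. (\<forall>k<n. legal_I M s r k \<and> legal_II r k) \<and> legal_I M s r n \<and> \<not> legal_II r n) \<longleftrightarrow>
      (\<forall>n\<le>N. legal_I M s r n)"
    unfolding le_less by metis
  ultimately show ?thesis using False by auto
qed

lemma won_by_II_iff:
  "won_by M s A PlayerII r \<longleftrightarrow>
    (\<forall>n. (\<forall>k\<le>n. legal_I M s r k) \<longrightarrow> legal_II r n) \<and> ((\<forall>n. legal_I M s r n) \<longrightarrow> outcome r \<in> A)"
proof (cases "\<forall>n. legal_I M s r n")
  case True
  then show ?thesis by auto
next
  case False
  then obtain N where N: "\<not> legal_I M s r N" "\<forall>k<N. legal_I M s r k"
    using exists_least_iff[of "\<lambda>n. \<not> legal_I M s r n"] by auto
  then have "(\<forall>k\<le>n. legal_I M s r k) \<longleftrightarrow> n < N" for n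
    by (metis not_le order_le_less_trans)
  moreover have "(\<forall>k<n. legal_I M s r k) \<and> \<not> legal_I M s r n \<longleftrightarrow> n = N" for n
    using N by (metis linorder_neqE_nat)
  then have "(\<exists>n. (\<forall>k<n. legal_I M s r k \<and> legal_II r k) \<and> \<not> legal_I M s r n) \<longleftrightarrow>
      (\<forall>n<N. legal_II r n)"
    by metis
  ultimately show ?thesis using False by auto
qed

lemma not_both_players_win:
  assumes "wins_game M PlayerI s A"
  shows "\<not> wins_game M PlayerII s A"
proof
  assume "wins_game M PlayerII s A"
  then obtain \<tau> where \<tau>: "\<And>r. follows_II \<tau> r \<Longrightarrow> won_by M s A PlayerII r"
    by auto
  obtain \<sigma> where \<sigma>: "\<And>r. follows_I \<sigma> r \<Longrightarrow> won_by M s A PlayerI r"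
    using assms by auto
  define r where "r = generated_seq (\<lambda>h. (\<sigma> h, \<tau> h (\<sigma> h)))"
  have "r n = (\<sigma> (history r n), \<tau> (history r n) (\<sigma> (history r n)))" for n
    unfolding r_def history_def by (rule generated_seq_unfold)
  then have "fst (r n) = \<sigma> (history r n)" "snd (r n) = \<tau> (history r n) (\<sigma> (history r n))" for n
    by (metis fst_conv, metis snd_conv)
  then have "follows_I \<sigma> r" "follows_II \<tau> r"
    by (simp_all add: follows_I_def follows_II_def)
  then show False
    using \<sigma> \<tau> won_by_exactly_one by blast
qed

definition run_I :: "(round list \<Rightarrow> real \<times> real) \<Rightarrow> (nat \<Rightarrow> bool) \<Rightarrow> nat \<Rightarrow> round" where
  "run_I \<sigma> x = generated_seq (\<lambda>h. (\<sigma> h, x (length h)))"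

lemma run_I_unfold: "run_I \<sigma> x n = (\<sigma> (history (run_I \<sigma> x) n), x n)"
  unfolding run_I_def by (subst generated_seq_unfold) (simp add: history_def)

lemma follows_I_run_I: "follows_I \<sigma> (run_I \<sigma> x)"
  using run_I_unfold[of \<sigma> x] by (metis follows_I_def fst_conv)

lemma outcome_run_I [simp]: "outcome (run_I \<sigma> x) = x"
proof
  show "outcome (run_I \<sigma> x) n = x n" for n
    using run_I_unfold[of \<sigma> x n] by (metis outcome_def snd_conv)
qed

lemma word_run_I [simp]: "word (run_I \<sigma> x) n = map x [0..<n]"
  by (simp add: word_conv_map)

lemma history_run_I_cong:
  assumes "map x [0..<n] = map y [0..<n]"
  shows "history (run_I \<sigma> x) n = history (run_I \<sigma> y) n"
  using assms
proof (induction n)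
  case (Suc n)
  then have "history (run_I \<sigma> x) n = history (run_I \<sigma> y) n" "x n = y n"
    by simp_all
  then show ?case
    by (simp add: history_Suc run_I_unfold[of \<sigma> _ n])
qed (simp add: history_def)

lemma mass_run_I_cong:
  assumes "map x [0..<n] = map y [0..<n]"
  shows "mass (run_I \<sigma> x) n = mass (run_I \<sigma> y) n"
proof (rule mass_cong)
  show "history (run_I \<sigma> x) n = history (run_I \<sigma> y) n"
    using assms by (rule history_run_I_cong)
  show "fst (run_I \<sigma> x 0) = fst (run_I \<sigma> y 0)"
    by (simp add: run_I_unfold[of \<sigma> _ 0] history_def)
qed

lemma legal_II_run_I_cong:
  assumes "map x [0..<n] = map y [0..<n]" "k < n"
  shows "legal_II (run_I \<sigma> x) k \<longleftrightarrow> legal_II (run_I \<sigma> y) k"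
  using assms by (intro legal_II_cong history_run_I_cong) (auto simp: map_eq_conv)

section \<open>Mass assignments\<close>

definition mass_assignment :: "(nat \<Rightarrow> bool) measure \<Rightarrow> real \<Rightarrow> (bool list \<Rightarrow> real) \<Rightarrow> bool" where
  "mass_assignment M s m \<longleftrightarrow>
     s < m [] \<and> (\<forall>t. admissible_mass M t (m t)) \<and> (\<forall>t. m (t @ [False]) + m (t @ [True]) = m t)"

definition vanishes_along :: "(bool list \<Rightarrow> real) \<Rightarrow> (nat \<Rightarrow> bool) \<Rightarrow> bool" where
  "vanishes_along m x \<longleftrightarrow> (\<exists>n. m (map x [0..<n]) = 0)"

lemma mass_assignment_snoc_eq_0:
  assumes "mass_assignment M s m" "m t = 0"
  shows "m (t @ [i]) = 0"
proof -
  have "m (t @ [False]) + m (t @ [True]) = 0" "0 \<le> m (t @ [False])" "0 \<le> m (t @ [True])"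
    using assms by (auto simp: mass_assignment_def admissible_mass_def)
  then show ?thesis by (cases i) auto
qed

lemma wins_game_I_if_mass_assignment:
  assumes m: "mass_assignment M s m" and vanishes: "\<forall>x\<in>A. vanishes_along m x"
  shows "wins_game M PlayerI s A"
proof -
  define \<sigma> where "\<sigma> h = (m (map snd h @ [False]), m (map snd h @ [True]))" for h :: "round list"
  have "won_by M s A PlayerI r" if "follows_I \<sigma> r" for r
  proof -
    have entry: "entry (fst (r n)) i = m (word r n @ [i])" for n i
      using that by (simp add: follows_I_def \<sigma>_def map_snd_history entry_def)
    have sum: "m (t @ [False]) + m (t @ [True]) = m t" for t
      using m by (simp add: mass_assignment_def)
    have mass: "mass r n = m (word r n)" for n
    proof (cases n)
      case 0
      then show ?thesis
        using sum[of "[]"] by (simp add: entry word_def)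
    qed (simp add: entry word_Suc)
    have "legal_I M s r n" for n
      unfolding legal_I_def entry mass
      using m by (auto simp: mass_assignment_def word_def)
    moreover have "outcome r \<notin> A" if legal: "\<forall>n. legal_II r n"
    proof
      assume "outcome r \<in> A"
      then obtain n where "m (word r n) = 0"
        using vanishes by (auto simp: vanishes_along_def word_conv_map)
      then have "mass r (Suc n) = 0"
        unfolding mass word_Suc by (rule mass_assignment_snoc_eq_0[OF m])
      then show False
        using legal by (simp add: legal_II_def)
    qed
    ultimately show ?thesis
      unfolding won_by_I_iff by blast
  qed
  then show ?thesis by auto
qed

definition pad :: "bool list \<Rightarrow> nat \<Rightarrow> bool" where
  "pad t k \<longleftrightarrow> k < length t \<and> t ! k"

lemma map_pad [simp]: "map (pad t) [0..<length t] = t"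
  by (rule nth_equalityI) (simp_all add: pad_def)

text \<open>After an illegal digit of II nothing is known about the moves of \<open>\<sigma>\<close>; the masses are then cut to 0.\<close>

definition mass_along :: "(round list \<Rightarrow> real \<times> real) \<Rightarrow> bool list \<Rightarrow> real" where
  "mass_along \<sigma> t = (let r = run_I \<sigma> (pad t) in
     if \<forall>k<length t. legal_II r k then mass r (length t) else 0)"

lemma mass_along_prefix:
  "mass_along \<sigma> (map x [0..<n]) =
    (if \<forall>k<n. legal_II (run_I \<sigma> x) k then mass (run_I \<sigma> x) n else 0)"
proof -
  have "map (pad (map x [0..<n])) [0..<n] = map x [0..<n]"
    by (simp add: pad_def)
  from legal_II_run_I_cong[OF this] mass_run_I_cong[OF this] show ?thesis
    by (auto simp: mass_along_def Let_def)
qed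

lemma mass_along_prefix_snoc:
  "mass_along \<sigma> (map x [0..<n] @ [i]) =
    (if \<forall>k<n. legal_II (run_I \<sigma> x) k then entry (fst (run_I \<sigma> x n)) i else 0)"
proof -
  let ?y = "x(n := i)"
  have prefix: "map ?y [0..<n] = map x [0..<n]"
    by simp
  have "mass (run_I \<sigma> ?y) (Suc n) = entry (fst (run_I \<sigma> x n)) i"
    using history_run_I_cong[OF prefix] by (simp add: run_I_unfold[of \<sigma> _ n])
  then have "mass_along \<sigma> (map ?y [0..<Suc n]) =
      (if \<forall>k<n. legal_II (run_I \<sigma> x) k then entry (fst (run_I \<sigma> x n)) i else 0)"
    unfolding mass_along_prefix
    using legal_II_run_I_cong[OF prefix] by (auto simp: less_Suc_eq legal_II_def simp del: mass.simps)
  then show ?thesis by simp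
qed

lemma mass_assignment_mass_along:
  assumes won: "\<And>x. won_by M s A PlayerI (run_I \<sigma> x)"
  shows "mass_assignment M s (mass_along \<sigma>)"
  unfolding mass_assignment_def
proof (intro conjI allI)
  have legal: "\<forall>k<n. legal_II (run_I \<sigma> x) k \<Longrightarrow> legal_I M s (run_I \<sigma> x) n" for x n
    using won[of x] unfolding won_by_I_iff by blast
  show "s < mass_along \<sigma> []"
    using legal[of 0 "pad []"] by (simp add: mass_along_def Let_def legal_I_def)
  fix t
  let ?r = "run_I \<sigma> (pad t)"
  have along:
    "mass_along \<sigma> t = (if \<forall>k<length t. legal_II ?r k then mass ?r (length t) else 0)"
    "mass_along \<sigma> (t @ [i]) =
      (if \<forall>k<length t. legal_II ?r k then entry (fst (?r (length t))) i else 0)" for i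
    using mass_along_prefix[of \<sigma> "pad t" "length t"]
      mass_along_prefix_snoc[of \<sigma> "pad t" "length t"] by simp_all
  show "admissible_mass M t (mass_along \<sigma> t)"
    using legal[of "length t" "pad t"] unfolding along
    by (simp add: legal_I_def admissible_mass_def)
  show "mass_along \<sigma> (t @ [False]) + mass_along \<sigma> (t @ [True]) = mass_along \<sigma> t"
    using legal[of "length t" "pad t"] unfolding along by (auto simp: legal_I_def)
qed

lemma ex_mass_assignment_if_wins_game_I:
  assumes "wins_game M PlayerI s A"
  obtains m where "mass_assignment M s m" "\<forall>x\<in>A. vanishes_along m x"
proof -
  obtain \<sigma> where won: "\<And>x. won_by M s A PlayerI (run_I \<sigma> x)"
    using assms follows_I_run_I unfolding wins_game.simps by blast
  have "\<forall>x\<in>A. vanishes_along (mass_along \<sigma>) x"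
  proof
    fix x assume "x \<in> A"
    then obtain n where "\<not> legal_II (run_I \<sigma> x) n"
      using won[of x] unfolding won_by_I_iff by auto
    then have "mass_along \<sigma> (map x [0..<Suc n]) = 0"
      unfolding mass_along_prefix by auto
    then show "vanishes_along (mass_along \<sigma>) x"
      unfolding vanishes_along_def by blast
  qed
  with mass_assignment_mass_along[OF won] show thesis
    by (rule that)
qed

section \<open>Measures on the Cantor space\<close>

lemma cylinder_Nil [simp]: "cylinder [] = UNIV"
  by (simp add: cylinder_def)

lemma mem_cylinder_snoc: "x \<in> cylinder (t @ [i]) \<longleftrightarrow> x \<in> cylinder t \<and> x (length t) = i"
  by (auto simp: cylinder_def less_Suc_eq nth_append)

lemma open_cylinder: "open (cylinder t)"
proof -
  have "cylinder t = {x. \<forall>k\<in>{..<length t}. x k \<in> {t ! k}}"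
    by (auto simp: cylinder_def)
  then show ?thesis
    using product_topology_basis'[of "{..<length t}" "\<lambda>k. {t ! k}" id]
    by (simp add: discrete_topology_class.open_discrete)
qed

lemma closed_memI_cylinder:
  fixes K :: "(nat \<Rightarrow> bool) set"
  assumes K: "closed K" and meets: "\<And>n. K \<inter> cylinder (map x [0..<n]) \<noteq> {}"
  shows "x \<in> K"
proof -
  have "\<exists>y. y \<in> K \<and> y \<in> cylinder (map x [0..<n])" for n
    using meets[of n] by blast
  then obtain y where y: "\<And>n. y n \<in> K" "\<And>n. y n \<in> cylinder (map x [0..<n])"
    by metis
  have "(\<lambda>n. y n k) \<longlonglongrightarrow> x k" for k
  proof (rule tendsto_eventually)
    show "eventually (\<lambda>n. y n k = x k) sequentially"
      using y(2) by (intro eventually_sequentiallyI[of "Suc k"]) (simp add: cylinder_def)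
  qed
  then have "limitin (product_topology (\<lambda>_. euclidean) UNIV) y x sequentially"
    by (simp add: limitin_componentwise)
  then have "y \<longlonglongrightarrow> x"
    by (simp add: euclidean_product_topology)
  with K y(1) show ?thesis
    by (rule closed_sequentially)
qed

definition rational_below :: "real \<Rightarrow> real \<Rightarrow> bool" where
  "rational_below q c \<longleftrightarrow> q \<in> \<rat> \<and> 0 \<le> q \<and> (q < c \<or> q = 0)"

lemma admissible_mass_iff_rational_below:
  "admissible_mass M t q \<longleftrightarrow> rational_below q (measure M (cylinder t))"
  by (auto simp: admissible_mass_def rational_below_def zero_less_measure_iff)

lemma rational_below_mono: "rational_below q c \<Longrightarrow> c \<le> d \<Longrightarrow> rational_below q d"
  by (auto simp: rational_below_def)

lemma rational_below_add_split:
  assumes "rational_below q (a + b)" "0 \<le> a" "0 \<le> b"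
  obtains c d where "rational_below c a" "rational_below d b" "c + d = q"
proof (cases "q = 0 \<or> a = 0 \<or> b = 0")
  case True
  then consider "q = 0" | "a = 0" | "b = 0" by blast
  then show thesis
  proof cases
    case 1
    then show thesis using that[of 0 0] by (simp add: rational_below_def)
  next
    case 2
    then show thesis using that[of 0 q] assms by (simp add: rational_below_def)
  next
    case 3
    then show thesis using that[of q 0] assms by (simp add: rational_below_def)
  qed
next
  case False
  then have "max 0 (q - b) < min a q"
    using assms by (auto simp: rational_below_def)
  then obtain c where "c \<in> \<rat>" "max 0 (q - b) < c" "c < min a q"
    using Rats_dense_in_real by blast
  then show thesis
    using that[of c "q - c"] assms(1) by (auto simp: rational_below_def)
qed

locale Cantor_probability = prob_space M for M :: "(nat \<Rightarrow> bool) measure" +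
  assumes sets_eq_borel: "sets M = sets borel"
begin

lemma space_eq_UNIV: "space M = UNIV"
  using sets_eq_imp_space_eq[OF sets_eq_borel] by simp

lemma sets_cylinder [simp]: "cylinder t \<in> sets M"
  using open_cylinder by (simp add: sets_eq_borel)

lemma prob_Int_cylinder_split:
  assumes "X \<in> sets M"
  shows "prob (X \<inter> cylinder t) =
    prob (X \<inter> cylinder (t @ [False])) + prob (X \<inter> cylinder (t @ [True]))"
proof -
  have "X \<inter> cylinder t = (X \<inter> cylinder (t @ [False])) \<union> (X \<inter> cylinder (t @ [True]))"
    and "(X \<inter> cylinder (t @ [False])) \<inter> (X \<inter> cylinder (t @ [True])) = {}"
    by (auto simp: mem_cylinder_snoc)
  then show ?thesis
    using assms by (metis finite_measure_Union sets.Int sets_cylinder)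
qed

lemma prob_cylinder_split:
  "prob (cylinder t) = prob (cylinder (t @ [False])) + prob (cylinder (t @ [True]))"
  using prob_Int_cylinder_split[OF sets.top, of t] by (simp add: space_eq_UNIV)

section \<open>Games on closed sets and complementary games\<close>

lemma ex_mass_assignment_below:
  assumes X: "X \<in> sets M" and s: "0 \<le> s" "s < prob X"
  obtains m where "mass_assignment M s m" "\<forall>t. rational_below (m t) (prob (X \<inter> cylinder t))"
proof -
  define below where "below t q \<longleftrightarrow> rational_below q (prob (X \<inter> cylinder t))" for t q
  obtain q where q: "q \<in> \<rat>" "s < q" "q < prob X"
    using Rats_dense_in_real s(2) by blast
  obtain m where m: "m [] = q" "\<And>t. below t (m t)" "\<And>t. m (t @ [False]) + m (t @ [True]) = m t"
  proof (rule dependent_tree_choice[of below q "\<lambda>b c. c False + c True = b"])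
    show "below [] q"
      using q s by (simp add: below_def rational_below_def)
    show "\<exists>c. c False + c True = b \<and> (\<forall>i. below (t @ [i]) (c i))" if "below t b" for t b
    proof -
      have "rational_below b (prob (X \<inter> cylinder (t @ [False])) + prob (X \<inter> cylinder (t @ [True])))"
        using \<open>below t b\<close> prob_Int_cylinder_split[OF X, of t] by (simp add: below_def)
      then obtain c d where "below (t @ [False]) c" "below (t @ [True]) d" "c + d = b"
        unfolding below_def by (rule rational_below_add_split) simp_all
      then show ?thesis
        by (intro exI[of _ "\<lambda>i. if i then d else c"]) (simp add: all_bool_eq)
    qed
  qed blast
  have "admissible_mass M t (m t)" for t
    unfolding admissible_mass_iff_rational_below
  proof (rule rational_below_mono)
    show "rational_below (m t) (prob (X \<inter> cylinder t))"
      using m(2) by (simp add: below_def)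
    show "prob (X \<inter> cylinder t) \<le> prob (cylinder t)"
      by (intro finite_measure_mono) auto
  qed
  then have "mass_assignment M s m"
    using m q by (simp add: mass_assignment_def)
  then show thesis
    using m(2) by (intro that) (auto simp: below_def)
qed

lemma wins_game_I_if_closed:
  assumes K: "closed K" "K \<inter> A = {}" and s: "0 \<le> s" "s < prob K"
  shows "wins_game M PlayerI s A"
proof -
  have "K \<in> sets M"
    using K(1) by (simp add: sets_eq_borel)
  then obtain m where m: "mass_assignment M s m"
    and below: "\<forall>t. rational_below (m t) (prob (K \<inter> cylinder t))"
    using s by (rule ex_mass_assignment_below)
  have "x \<in> K" if "\<not> vanishes_along m x" for x
  proof (rule closed_memI_cylinder[OF K(1)])
    fix n
    have "prob (K \<inter> cylinder (map x [0..<n])) \<noteq> 0"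
      using that below[rule_format, of "map x [0..<n]"]
      by (auto simp: vanishes_along_def rational_below_def)
    then show "K \<inter> cylinder (map x [0..<n]) \<noteq> {}"
      by (metis measure_empty)
  qed
  then have "\<forall>x\<in>A. vanishes_along m x"
    using K(2) by blast
  with m show ?thesis
    by (rule wins_game_I_if_mass_assignment)
qed

text \<open>
  Against masses \<open>m'\<close> played by I, player II imagines a second mass assignment \<open>m\<close> for the same digits
  and maintains \<open>prob (cylinder t) < m'\<^bsub>t\<^esub> + m\<^bsub>t\<^esub>\<close>.
\<close>

definition heavier_digit :: "(bool list \<Rightarrow> real) \<Rightarrow> round list \<Rightarrow> real \<times> real \<Rightarrow> bool" where
  "heavier_digit m h q \<longleftrightarrow> (let t = map snd h @ [True] in prob (cylinder t) < entry q True + m t)"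

lemma prob_cylinder_less_mass_add:
  assumes m: "mass_assignment M s m" and follows: "follows_II (heavier_digit m) r"
    and legal: "\<forall>k\<le>n. legal_I M (1 - s) r k"
  shows "prob (cylinder (word r (Suc n))) < mass r (Suc n) + m (word r (Suc n))"
proof -
  let ?heavy = "\<lambda>n. prob (cylinder (word r n)) < mass r n + m (word r n)"
  have base: "?heavy 0" if "legal_I M (1 - s) r 0"
    using that m prob_space
    by (simp add: legal_I_def mass_assignment_def word_def space_eq_UNIV)
  have step: "?heavy (Suc n)" if "legal_I M (1 - s) r n" "?heavy n" for n
  proof -
    have "m (word r n @ [False]) + m (word r n @ [True]) = m (word r n)"
      using m by (simp add: mass_assignment_def)
    then have "prob (cylinder (word r n @ [False])) + prob (cylinder (word r n @ [True])) <
        (entry (fst (r n)) False + m (word r n @ [False])) +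
        (entry (fst (r n)) True + m (word r n @ [True]))"
      using that prob_cylinder_split[of "word r n"] unfolding legal_I_def by linarith
    moreover have "outcome r n \<longleftrightarrow>
        prob (cylinder (word r n @ [True])) < entry (fst (r n)) True + m (word r n @ [True])"
      using follows
      by (simp add: follows_II_def heavier_digit_def Let_def map_snd_history outcome_def)
    ultimately show ?thesis
      by (cases "outcome r n") (auto simp: word_Suc)
  qed
  show ?thesis
    using legal by (induction n) (auto intro: base step simp del: mass.simps)
qed

lemma wins_game_II_complement:
  assumes "wins_game M PlayerI s A"
  shows "wins_game M PlayerII (1 - s) (- A)"
proof -
  obtain m where m: "mass_assignment M s m" "\<forall>x\<in>A. vanishes_along m x"
    using assms by (rule ex_mass_assignment_if_wins_game_I)
  have "won_by M (1 - s) (- A) PlayerII r" if follows: "follows_II (heavier_digit m) r" for r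
    unfolding won_by_II_iff
  proof (intro conjI allI impI)
    note heavy = prob_cylinder_less_mass_add[OF m(1) follows]
    show "legal_II r n" if "\<forall>k\<le>n. legal_I M (1 - s) r k" for n
    proof -
      have "m (word r (Suc n)) \<le> prob (cylinder (word r (Suc n)))"
        using m(1) by (simp add: mass_assignment_def admissible_mass_def)
      then show ?thesis
        using heavy[OF that] by (auto simp: legal_II_def)
    qed
    assume legal: "\<forall>n. legal_I M (1 - s) r n"
    have "m (word r n) \<noteq> 0" for n
    proof
      assume "m (word r n) = 0"
      then have "m (word r (Suc n)) = 0"
        unfolding word_Suc by (rule mass_assignment_snoc_eq_0[OF m(1)])
      moreover have "mass r (Suc n) \<le> prob (cylinder (word r (Suc n)))"
        using legal by (simp add: legal_I_def admissible_mass_def word_Suc)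
      ultimately show False
        using heavy[of n] legal by simp
    qed
    then show "outcome r \<in> - A"
      using m(2) by (auto simp: vanishes_along_def word_conv_map)
  qed
  then show ?thesis by auto
qed

end

section \<open>Inner approximation of sets won by player II\<close>

definition conforming_round ::
    "(nat \<Rightarrow> bool) measure \<Rightarrow> real \<Rightarrow> (round list \<Rightarrow> real \<times> real \<Rightarrow> bool) \<Rightarrow> (nat \<Rightarrow> round) \<Rightarrow> nat \<Rightarrow> bool"
  where
  "conforming_round M s \<tau> r n \<longleftrightarrow>
     snd (r n) = \<tau> (history r n) (fst (r n)) \<and> legal_I M s r n \<and> legal_II r n"

definition conforming_outcomes ::
    "(nat \<Rightarrow> bool) measure \<Rightarrow> real \<Rightarrow> (round list \<Rightarrow> real \<times> real \<Rightarrow> bool) \<Rightarrow> (nat \<Rightarrow> bool) set" where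
  "conforming_outcomes M s \<tau> = outcome ` {r. \<forall>n. conforming_round M s \<tau> r n}"

definition conforming_history ::
    "(nat \<Rightarrow> bool) measure \<Rightarrow> real \<Rightarrow> (round list \<Rightarrow> real \<times> real \<Rightarrow> bool) \<Rightarrow> round list \<Rightarrow> bool" where
  "conforming_history M s \<tau> h \<longleftrightarrow>
     (\<exists>r. history r (length h) = h \<and> (\<forall>k<length h. conforming_round M s \<tau> r k))"

definition rational_rounds :: "round set" where
  "rational_rounds = (\<rat> \<times> \<rat>) \<times> UNIV"

lemma mem_conforming_outcomes_iff:
  "x \<in> conforming_outcomes M s \<tau> \<longleftrightarrow>
    (\<exists>r. follows_II \<tau> r \<and> (\<forall>n. legal_I M s r n) \<and> (\<forall>n. legal_II r n) \<and> outcome r = x)"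
  by (auto simp: conforming_outcomes_def conforming_round_def follows_II_def)

lemma countable_rational_rounds: "countable rational_rounds"
  by (simp add: rational_rounds_def countable_rat)

lemma conforming_round_imp_rational: "conforming_round M s \<tau> r n \<Longrightarrow> r n \<in> rational_rounds"
  by (auto simp: conforming_round_def legal_I_def admissible_mass_def rational_rounds_def
      entry_def mem_Times_iff all_bool_eq)

lemma conforming_round_cong:
  assumes "history r (Suc n) = history r' (Suc n)"
  shows "conforming_round M s \<tau> r n \<longleftrightarrow> conforming_round M s \<tau> r' n"
proof -
  have "r n = r' n" "history r n = history r' n"
    using assms by (simp_all add: history_eq_iff)
  then show ?thesis
    unfolding conforming_round_def legal_I_cong[OF assms] legal_II_cong[OF assms] by simp
qed

lemma conforming_history_iff:
  "conforming_history M s \<tau> (history r n) \<longleftrightarrow> (\<forall>k<n. conforming_round M s \<tau> r k)"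
proof
  assume "conforming_history M s \<tau> (history r n)"
  then obtain r' where r': "history r' n = history r n" "\<forall>k<n. conforming_round M s \<tau> r' k"
    by (auto simp: conforming_history_def)
  have "conforming_round M s \<tau> r' k \<longleftrightarrow> conforming_round M s \<tau> r k" if "k < n" for k
    using r'(1) that by (intro conforming_round_cong) (simp add: history_eq_iff)
  with r'(2) show "\<forall>k<n. conforming_round M s \<tau> r k"
    by blast
qed (auto simp: conforming_history_def)

lemma conforming_outcomes_eq_Souslin_operation:
  "conforming_outcomes M s \<tau> = Souslin_operation rational_rounds
    (\<lambda>h. if conforming_history M s \<tau> h then cylinder (map snd h) else {})"
proof -
  define P where "P h = (if conforming_history M s \<tau> h then cylinder (map snd h) else {})" for h
  have "x \<in> P (history r n) \<longleftrightarrow> (\<forall>k<n. conforming_round M s \<tau> r k) \<and> (\<forall>k<n. x k = outcome r k)"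
    for x r n
    by (simp add: P_def conforming_history_iff map_snd_history cylinder_def word_def)
  then have "(\<forall>n. x \<in> P (history r n)) \<longleftrightarrow> (\<forall>n. conforming_round M s \<tau> r n) \<and> x = outcome r" for x r
    by (auto simp: fun_eq_iff)
  then have "x \<in> Souslin_operation rational_rounds P \<longleftrightarrow> x \<in> conforming_outcomes M s \<tau>" for x
    unfolding mem_Souslin_operation_iff conforming_outcomes_def history_def[symmetric]
    by (auto intro!: bexI conforming_round_imp_rational)
  then show ?thesis
    by (auto simp: P_def[abs_def])
qed

context Cantor_probability
begin

lemma conforming_outcomes_in_completion: "conforming_outcomes M s \<tau> \<in> sets (completion M)"
  unfolding conforming_outcomes_eq_Souslin_operation
  by (intro Souslin_operation_in_completion countable_rational_rounds) simp

lemma measure_ge_if_wins_game_II: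
  assumes B: "B \<in> sets (completion M)" and win: "wins_game M PlayerII p B" and p: "0 \<le> p"
  shows "1 - p \<le> measure (completion M) B"
proof (rule ccontr)
  interpret completion: prob_space "completion M" by (rule prob_space_completion)
  assume "\<not> 1 - p \<le> measure (completion M) B"
  then have "p < measure (completion M) (space M - B)"
    using completion.prob_compl[OF B] by simp
  moreover have "space M - B \<in> sets (completion M)"
    using sets.compl_sets[OF B] by simp
  ultimately obtain K where K: "closed K" "K \<subseteq> space M - B" "p < prob K"
    using closed_inner_approximation[OF finite_measure_axioms sets_eq_borel] by metis
  then have "wins_game M PlayerI p B"
    using p by (intro wins_game_I_if_closed[of K]) auto
  then show False
    using win not_both_players_win by blast
qed

lemma closed_subset_if_wins_game_II:
  assumes win: "wins_game M PlayerII p B" and p: "0 \<le> p" and c: "c < 1 - p"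
  obtains K where "closed K" "K \<subseteq> B" "c < prob K"
proof -
  obtain \<tau> where \<tau>: "\<And>r. follows_II \<tau> r \<Longrightarrow> won_by M p B PlayerII r"
    using win by auto
  let ?W = "conforming_outcomes M p \<tau>"
  have "won_by M p ?W PlayerII r" if "follows_II \<tau> r" for r
    using \<tau>[OF that] that unfolding won_by_II_iff mem_conforming_outcomes_iff by blast
  then have "wins_game M PlayerII p ?W" by auto
  then have "1 - p \<le> measure (completion M) ?W"
    using p by (rule measure_ge_if_wins_game_II[OF conforming_outcomes_in_completion])
  with c have "c < measure (completion M) ?W"
    by (rule order_less_le_trans)
  then obtain K where K: "closed K" "K \<subseteq> ?W" "c < prob K"
    by (rule closed_inner_approximation[OF finite_measure_axioms sets_eq_borel
        conforming_outcomes_in_completion])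
  have "?W \<subseteq> B"
  proof
    fix x assume "x \<in> ?W"
    then obtain r where "follows_II \<tau> r" "\<forall>n. legal_I M p r n" "outcome r = x"
      by (auto simp: mem_conforming_outcomes_iff)
    then show "x \<in> B"
      using \<tau>[of r] unfolding won_by_II_iff by simp
  qed
  then have "K \<subseteq> B"
    using K(2) by (rule order_trans[rotated])
  with K(1) show thesis
    using K(3) by (rule that)
qed

end

section \<open>The second Borel--Cantelli lemma for measure games\<close>

lemma prod_one_minus_tail_small:
  fixes s :: "nat \<Rightarrow> real"
  assumes s: "\<And>i. 0 \<le> s i" "\<And>i. s i \<le> 1"
    and diverges: "filterlim (\<lambda>n. \<Sum>i<n. s i) at_top sequentially" and d: "0 < d"
  obtains F where "finite F" "F \<subseteq> {m..}" "\<And>i. i \<in> F \<Longrightarrow> 0 < s i" "(\<Prod>i\<in>F. 1 - s i) < d"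
proof -
  have "eventually (\<lambda>n. (\<Sum>i<n. s i) > (\<Sum>i<m. s i) - ln d) sequentially"
    using diverges by (simp add: filterlim_at_top_dense)
  then obtain n where n: "m \<le> n" "(\<Sum>i<n. s i) > (\<Sum>i<m. s i) - ln d"
    using eventually_happens[OF eventually_conj[OF eventually_ge_at_top[of m]]] by fastforce
  define F where "F = {i\<in>{m..<n}. 0 < s i}"
  have "(\<Sum>i<n. s i) = (\<Sum>i<m. s i) + (\<Sum>i=m..<n. s i)"
    using sum.atLeastLessThan_concat[of 0 m n s] n(1) by (simp add: atLeast0LessThan)
  moreover have "(\<Sum>i\<in>F. s i) = (\<Sum>i=m..<n. s i)"
    unfolding F_def using s(1) by (intro sum.mono_neutral_left) (auto simp: less_le)
  ultimately have large: "- (\<Sum>i\<in>F. s i) < ln d"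
    using n(2) by simp
  have "(\<Prod>i\<in>F. 1 - s i) \<le> (\<Prod>i\<in>F. exp (- s i))"
    using s(2) exp_ge_add_one_self[of "- s _"] by (intro prod_mono conjI) simp_all
  also have "\<dots> = exp (- (\<Sum>i\<in>F. s i))"
    by (simp add: exp_sum F_def sum_negf[symmetric])
  also have "\<dots> < exp (ln d)"
    using large by simp
  finally have "(\<Prod>i\<in>F. 1 - s i) < d"
    using d by simp
  then show thesis
    by (intro that[of F]) (auto simp: F_def)
qed

lemma (in prob_space) prob_INT_ge:
  assumes E: "\<And>n :: nat. E n \<in> events" and d: "\<And>n. 1 - d n \<le> prob (E n)" and sums: "d sums D"
  shows "1 - D \<le> prob (\<Inter>n. E n)"
proof -
  have compl_le: "prob (space M - E n) \<le> d n" for n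
    using d[of n] E by (simp add: prob_compl)
  have "summable (\<lambda>n. prob (space M - E n))"
    using compl_le by (intro summable_comparison_test[OF _ sums_summable[OF sums]]) auto
  moreover from this have "(\<Sum>n. prob (space M - E n)) \<le> D"
    using suminf_le[OF compl_le] sums_summable[OF sums] sums_unique[OF sums] by simp
  ultimately have "prob (\<Union>n. space M - E n) \<le> D"
    using E finite_measure_subadditive_countably[of "\<lambda>n. space M - E n"] by fastforce
  moreover have "(\<Union>n. space M - E n) = space M - (\<Inter>n. E n)"
    by blast
  ultimately show ?thesis
    using prob_compl[of "\<Inter>n. E n"] E by simp
qed

lemma mutually_independentD:
  assumes "mutually_independent M I A" "finite F" "F \<noteq> {}" "F \<subseteq> I"
    and "\<And>i. i \<in> F \<Longrightarrow> 0 \<le> s i \<and> s i < 1" "\<And>i. i \<in> F \<Longrightarrow> wins_game M P (s i) (- A i)"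
  shows "wins_game M P (\<Prod>i\<in>F. s i) (\<Union>i\<in>F. - A i)"
proof -
  have "finite F \<and> F \<noteq> {} \<and> F \<subseteq> I \<and> (\<forall>i\<in>F. 0 \<le> s i \<and> s i < 1) \<and> (\<forall>i\<in>F. wins_game M P (s i) (- A i))"
    using assms(2-) by simp
  then show ?thesis
    by (rule assms(1)[unfolded mutually_independent_def, rule_format (no_asm)])
qed

lemma (in Cantor_probability) closed_subset_of_tail_union:
  fixes A :: "nat \<Rightarrow> (nat \<Rightarrow> bool) set"
  assumes indep: "mutually_independent M UNIV A"
    and s: "\<And>i. 0 \<le> s i \<and> s i < 1"
    and diverges: "filterlim (\<lambda>n. \<Sum>i<n. s i) at_top sequentially"
    and win: "\<And>i. wins_game M PlayerI (s i) (A i)" and d: "0 < d"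
  shows "\<exists>K. closed K \<and> K \<subseteq> (\<Union>i\<in>{m..}. - A i) \<and> 1 - d < prob K"
proof -
  obtain F where F: "finite F" "F \<subseteq> {m..}" "\<And>i. i \<in> F \<Longrightarrow> 0 < s i"
    and prod: "(\<Prod>i\<in>F. 1 - s i) < min d 1"
    using prod_one_minus_tail_small[of s "min d 1" m] s diverges d
    by (metis less_imp_le min_less_iff_conj zero_less_one)
  have "F \<noteq> {}"
    using prod by auto
  then have "wins_game M PlayerII (\<Prod>i\<in>F. 1 - s i) (\<Union>i\<in>F. - A i)"
    using F s wins_game_II_complement[OF win]
    by (intro mutually_independentD[OF indep]) (auto simp: less_imp_le)
  moreover have "0 \<le> (\<Prod>i\<in>F. 1 - s i)"
    using s by (intro prod_nonneg) (simp add: less_imp_le)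
  moreover have "1 - d < 1 - (\<Prod>i\<in>F. 1 - s i)"
    using prod by simp
  ultimately obtain K where "closed K" "K \<subseteq> (\<Union>i\<in>F. - A i)" "1 - d < prob K"
    by (rule closed_subset_if_wins_game_II)
  moreover have "(\<Union>i\<in>F. - A i) \<subseteq> (\<Union>i\<in>{m..}. - A i)"
    using F(2) by (rule UN_mono) simp
  ultimately show ?thesis
    by (meson order_trans)
qed

theorem theorem3p3:
  fixes M :: "(nat \<Rightarrow> bool) measure"
    and A :: "nat \<Rightarrow> (nat \<Rightarrow> bool) set"
    and s :: "nat \<Rightarrow> real"
    and \<epsilon> :: real
  assumes "prob_space M" and "sets M = sets borel"
    and "mutually_independent M UNIV A"
    and "\<And>i. 0 \<le> s i \<and> s i < 1"
    and "filterlim (\<lambda>n. \<Sum>i<n. s i) at_top sequentially"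
    and "\<And>i. wins_game M PlayerI (s i) (A i)"
    and "0 < \<epsilon>" and "\<epsilon> \<le> 1"
  shows "wins_game M PlayerI (1 - \<epsilon>) (\<Union>m. \<Inter>i\<in>{m..}. A i)"
proof -
  interpret Cantor_probability M
    using assms(1,2) by (simp add: Cantor_probability_def Cantor_probability_axioms_def)
  define d where "d m = \<epsilon> / 2 * (1 / 2) ^ Suc m" for m :: nat
  have "\<exists>K. closed K \<and> K \<subseteq> (\<Union>i\<in>{m..}. - A i) \<and> 1 - d m < prob K" for m
    using assms(7) by (intro closed_subset_of_tail_union[OF assms(3-6)]) (simp add: d_def)
  then obtain K where K: "\<And>m. closed (K m)" "\<And>m. K m \<subseteq> (\<Union>i\<in>{m..}. - A i)"
    "\<And>m. 1 - d m < prob (K m)"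
    by metis
  have "d sums (\<epsilon> / 2)"
    unfolding d_def using sums_mult[OF power_half_series, of "\<epsilon> / 2"] by simp
  then have "1 - \<epsilon> / 2 \<le> prob (\<Inter>m. K m)"
    using K(1,3) by (intro prob_INT_ge[of K d]) (simp_all add: sets_eq_borel less_imp_le)
  then have "1 - \<epsilon> < prob (\<Inter>m. K m)"
    using assms(7) by simp
  moreover have "closed (\<Inter>m. K m)"
    using K(1) by blast
  moreover have "(\<Inter>m. K m) \<inter> (\<Union>m. \<Inter>i\<in>{m..}. A i) = {}"
    using K(2) by blast
  ultimately show ?thesis
    using assms(8) by (intro wins_game_I_if_closed) auto
qed

end
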